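(* Let $(F,\eta)$ be an $\mathcal{E}$-pointed endofunctor of $\mathcal{C}$ and let $\mathcal{S}$ be a syntopogenous structure on $\mathcal{C}$ with respect to $\mathcal{M}$. For $X\in\mathcal{C}$ put $\mathcal{S}^{F,\eta}_X=\{\sqsubset^{F,\eta}_X \;|\; \sqsubset_{FX}\in\mathcal{S}_{FX}\}$, where for $m,n\in \mathrm{sub}X$ $$m\sqsubset^{F,\eta}_X n \iff \eta_X(m)\sqsubset_{FX} p \text{ and } \eta_X^{-1}(p)\le n \text{ for some } p\in \mathrm{sub}FX .$$ Then $\mathcal{S}^{F,\eta}=\{\mathcal{S}^{F,\eta}_X\;|\;X\in\mathcal{C}\}$ is the coarsest syntopogenous structure on $\mathcal{C}$ with respect to $\mathcal{M}$ for which every $\eta_X:X\to FX$ is $(\mathcal{S}^{F,\eta},\mathcal{S})$-continuous. If $\mathcal{S}$ is interpolative (respectively co-perfect), then $\mathcal{S}^{F,\eta}$ is interpolative (respectively co-perfect).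
   Context: $\mathcal{C}$ is a category with a proper $(\mathcal{E},\mathcal{M})$-factorization system for morphisms ($\mathcal{E}$ consists of epimorphisms, $\mathcal{M}$ of monomorphisms), and it is $\mathcal{M}$-complete: pullbacks of $\mathcal{M}$-morphisms along arbitrary morphisms and arbitrary $\mathcal{M}$-intersections exist and are again in $\mathcal{M}$. The class $\mathcal{E}$ is stable under pullbacks along $\mathcal{M}$-morphisms. For $X\in\mathcal{C}$, $\mathrm{sub}X=\{m\in\mathcal{M}\mid \mathrm{cod}(m)=X\}$, ordered by $n\le m$ iff $m\circ j=n$ for some $j$; isomorphic subobjects are identified, so $\mathrm{sub}X$ is a (possibly large) complete lattice. For $f:X\to Y$, $f(m)$ is the $\mathcal{M}$-component of the factorization of $f\circ m$ and $f^{-1}(n)$ is the pullback of $n$ along $f$; $f(m)\le n$ iff $m\le f^{-1}(n)$. A topogenous order on $\mathcal{C}$ is a family $\sqsubset=\{\sqsubset_X\mid X\in\mathcal{C}\}$ of relations $\sqsubset_X$ on $\mathrm{sub}X$ with (T1) $m\sqsubset_X n\Rightarrow m\le n$; (T2) $m\le n\sqsubset_X p\le q\Rightarrow m\sqsubset_X q$; (T3) for every $f:X\to Y$, $m\sqsubset_Y n\Rightarrow f^{-1}(m)\sqsubset_X f^{-1}(n)$. A relation $\sqsubset_X$ is $\bigwedge$-preserving if ($m\sqsubset_X n_i$ for all $i\in I$) implies $m\sqsubset_X\bigwedge n_i$, and it interpolates (is interpolative) if $m\sqsubset_X n$ implies $m\sqsubset_X p\sqsubset_X n$ for some $p$. A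 syntopogenous structure on $\mathcal{C}$ with respect to $\mathcal{M}$ is a family $\mathcal{S}=\{\mathcal{S}_X\mid X\in\mathcal{C}\}$, each $\mathcal{S}_X$ a set of relations on $\mathrm{sub}X$, such that (S1) each $\sqsubset_X\in\mathcal{S}_X$ satisfies (T1) and (T2); (S2) $\mathcal{S}_X$ is directed with respect to inclusion; (S3) the relations $\bigcup\mathcal{S}_X$ ($X\in\mathcal{C}$) form an interpolative topogenous order. Order: $\mathcal{S}\le\mathcal{S}'$ iff for all $X$ and $\sqsubset_X\in\mathcal{S}_X$ there is $\sqsubset'_X\in\mathcal{S}'_X$ with $\sqsubset_X\subseteq\sqsubset'_X$; "coarsest" means least for $\le$. $\mathcal{S}$ is co-perfect (interpolative) if every $\sqsubset_X\in\mathcal{S}_X$, $X\in\mathcal{C}$, is $\bigwedge$-preserving (interpolates). A morphism $f:X\to Y$ is $(\mathcal{S},\mathcal{S}')$-continuous if for all $\sqsubset'_Y\in\mathcal{S}'_Y$ there is $\sqsubset_X\in\mathcal{S}_X$ such that $f(m)\sqsubset'_Y n\Rightarrow m\sqsubset_X f^{-1}(n)$ for all $m\in\mathrm{sub}X$, $n\in\mathrm{sub}Y$. A pointed endofunctor $(F,\eta)$ is a functor $F:\mathcal{C}\to\mathcal{C}$ with a natural transformation $\eta:1_{\mathcal{C}}\to F$; it is $\mathcal{E}$-pointed if every $\eta_X\in\mathcal{E}$. *)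

theory Defs
  imports Main
begin

text \<open>Objects and morphisms live in two unrelated types, so no smallness is imposed.
  \<open>g \<cdot>\<^bsub>C\<^esub> f\<close> is first \<open>f\<close>, then \<open>g\<close>; its value is irrelevant
  when the two morphisms are not composable.\<close>

record ('o, 'a) precategory =
  Ob :: "'o set"
  Ar :: "'a set"
  Dom :: "'a \<Rightarrow> 'o"
  Cod :: "'a \<Rightarrow> 'o"
  Id :: "'o \<Rightarrow> 'a"
  Comp :: "'a \<Rightarrow> 'a \<Rightarrow> 'a"  (infixl "\<cdot>\<index>" 70)

definition hom :: "('o, 'a) precategory \<Rightarrow> 'o \<Rightarrow> 'o \<Rightarrow> 'a set" where
  "hom C X Y = {f \<in> Ar C. Dom C f = X \<and> Cod C f = Y}"

locale category =
  fixes C :: "('o, 'a) precategory" (structure)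
  assumes dom_in_Ob: "f \<in> Ar C \<Longrightarrow> Dom C f \<in> Ob C"
    and cod_in_Ob: "f \<in> Ar C \<Longrightarrow> Cod C f \<in> Ob C"
    and id_in_hom: "X \<in> Ob C \<Longrightarrow> Id C X \<in> hom C X X"
    and comp_in_hom: "f \<in> hom C X Y \<Longrightarrow> g \<in> hom C Y Z \<Longrightarrow> g \<cdot> f \<in> hom C X Z"
    and comp_id_right: "f \<in> hom C X Y \<Longrightarrow> f \<cdot> Id C X = f"
    and comp_id_left: "f \<in> hom C X Y \<Longrightarrow> Id C Y \<cdot> f = f"
    and comp_assoc: "f \<in> hom C W X \<Longrightarrow> g \<in> hom C X Y \<Longrightarrow> h \<in> hom C Y Z
      \<Longrightarrow> h \<cdot> (g \<cdot> f) = (h \<cdot> g) \<cdot> f"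

definition mono_ar :: "('o, 'a) precategory \<Rightarrow> 'a \<Rightarrow> bool" where
  "mono_ar C m \<longleftrightarrow> m \<in> Ar C \<and>
    (\<forall>Z. \<forall>g \<in> hom C Z (Dom C m). \<forall>h \<in> hom C Z (Dom C m). m \<cdot>\<^bsub>C\<^esub> g = m \<cdot>\<^bsub>C\<^esub> h \<longrightarrow> g = h)"

definition epi_ar :: "('o, 'a) precategory \<Rightarrow> 'a \<Rightarrow> bool" where
  "epi_ar C e \<longleftrightarrow> e \<in> Ar C \<and>
    (\<forall>Z. \<forall>g \<in> hom C (Cod C e) Z. \<forall>h \<in> hom C (Cod C e) Z. g \<cdot>\<^bsub>C\<^esub> e = h \<cdot>\<^bsub>C\<^esub> e \<longrightarrow> g = h)"

definition iso_ar :: "('o, 'a) precategory \<Rightarrow> 'a \<Rightarrow> bool" where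
  "iso_ar C h \<longleftrightarrow> h \<in> Ar C \<and>
    (\<exists>k \<in> hom C (Cod C h) (Dom C h).
      k \<cdot>\<^bsub>C\<^esub> h = Id C (Dom C h) \<and> h \<cdot>\<^bsub>C\<^esub> k = Id C (Cod C h))"

text \<open>\<open>is_pullback C f n n' f'\<close>: the square \<open>f \<cdot> n' = n \<cdot> f'\<close> is a pullback,
  so that \<open>n'\<close> is a pullback of \<open>n\<close> along \<open>f\<close>.\<close>

definition is_pullback :: "('o, 'a) precategory \<Rightarrow> 'a \<Rightarrow> 'a \<Rightarrow> 'a \<Rightarrow> 'a \<Rightarrow> bool" where
  "is_pullback C f n n' f' \<longleftrightarrow>
    f \<in> Ar C \<and> n \<in> Ar C \<and> n' \<in> Ar C \<and> f' \<in> Ar C \<and>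
    Cod C f = Cod C n \<and> Dom C n' = Dom C f' \<and> Cod C n' = Dom C f \<and> Cod C f' = Dom C n \<and>
    f \<cdot>\<^bsub>C\<^esub> n' = n \<cdot>\<^bsub>C\<^esub> f' \<and>
    (\<forall>Z. \<forall>u \<in> hom C Z (Dom C f). \<forall>v \<in> hom C Z (Dom C n). f \<cdot>\<^bsub>C\<^esub> u = n \<cdot>\<^bsub>C\<^esub> v \<longrightarrow>
      (\<exists>!w. w \<in> hom C Z (Dom C n') \<and> n' \<cdot>\<^bsub>C\<^esub> w = u \<and> f' \<cdot>\<^bsub>C\<^esub> w = v))"

text \<open>The multiple pullback of a (possibly empty) family of monomorphisms with codomain \<open>X\<close>;
  as they are monic, the legs of a cone are determined by its diagonal \<open>t\<close>.\<close>

definition is_intersection :: "('o, 'a) precategory \<Rightarrow> 'o \<Rightarrow> 'a set \<Rightarrow> 'a \<Rightarrow> bool" where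
  "is_intersection C X A m \<longleftrightarrow>
    m \<in> Ar C \<and> Cod C m = X \<and>
    (\<forall>n \<in> A. \<exists>j \<in> hom C (Dom C m) (Dom C n). n \<cdot>\<^bsub>C\<^esub> j = m) \<and>
    (\<forall>Z. \<forall>t \<in> hom C Z X. (\<forall>n \<in> A. \<exists>j \<in> hom C Z (Dom C n). n \<cdot>\<^bsub>C\<^esub> j = t) \<longrightarrow>
      (\<exists>!w. w \<in> hom C Z (Dom C m) \<and> m \<cdot>\<^bsub>C\<^esub> w = t))"

locale proper_factorization_system = category C
  for C :: "('o, 'a) precategory" (structure) +
  fixes E M :: "'a set"
  assumes E_epi: "e \<in> E \<Longrightarrow> epi_ar C e"
    and M_mono: "m \<in> M \<Longrightarrow> mono_ar C m"
    and E_iso_closed: "e \<in> E \<Longrightarrow> iso_ar C h \<Longrightarrow> Dom C h = Cod C e \<Longrightarrow> h \<cdot> e \<in> E"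
    and M_iso_closed: "m \<in> M \<Longrightarrow> iso_ar C h \<Longrightarrow> Cod C h = Dom C m \<Longrightarrow> m \<cdot> h \<in> M"
    and factorization: "f \<in> Ar C \<Longrightarrow>
      \<exists>e \<in> E. \<exists>m \<in> M. Dom C e = Dom C f \<and> Cod C e = Dom C m \<and> Cod C m = Cod C f \<and> f = m \<cdot> e"
    and diagonal: "\<lbrakk>e \<in> E; m \<in> M; u \<in> hom C (Dom C e) (Dom C m); v \<in> hom C (Cod C e) (Cod C m);
      m \<cdot> u = v \<cdot> e\<rbrakk> \<Longrightarrow> \<exists>!d. d \<in> hom C (Cod C e) (Dom C m) \<and> d \<cdot> e = u \<and> m \<cdot> d = v"

definition M_over :: "('o, 'a) precategory \<Rightarrow> 'a set \<Rightarrow> 'o \<Rightarrow> 'a set" where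
  "M_over C M X = {m \<in> M. Cod C m = X}"

locale M_complete_category = proper_factorization_system C E M
  for C :: "('o, 'a) precategory" (structure) and E M :: "'a set" +
  assumes pullback_exists: "n \<in> M \<Longrightarrow> f \<in> Ar C \<Longrightarrow> Cod C f = Cod C n
      \<Longrightarrow> \<exists>n' f'. is_pullback C f n n' f'"
    and pullback_in_M: "n \<in> M \<Longrightarrow> is_pullback C f n n' f' \<Longrightarrow> n' \<in> M"
    and intersection_exists: "X \<in> Ob C \<Longrightarrow> A \<subseteq> M_over C M X \<Longrightarrow> \<exists>m. is_intersection C X A m"
    and intersection_in_M: "X \<in> Ob C \<Longrightarrow> A \<subseteq> M_over C M X \<Longrightarrow> is_intersection C X A m \<Longrightarrow> m \<in> M"

definition pullback_stable_along :: "('o, 'a) precategory \<Rightarrow> 'a set \<Rightarrow> 'a set \<Rightarrow> bool" where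
  "pullback_stable_along C E M \<longleftrightarrow>
    (\<forall>e \<in> E. \<forall>m \<in> M. \<forall>e' m'. is_pullback C m e e' m' \<longrightarrow> e' \<in> E)"

definition sub_iso :: "('o, 'a) precategory \<Rightarrow> 'a set \<Rightarrow> 'o \<Rightarrow> ('a \<times> 'a) set" where
  "sub_iso C M X = {(m, n). m \<in> M_over C M X \<and> n \<in> M_over C M X \<and>
    (\<exists>h \<in> hom C (Dom C m) (Dom C n). iso_ar C h \<and> n \<cdot>\<^bsub>C\<^esub> h = m)}"

text \<open>A subobject is the whole class of isomorphic morphisms in \<open>M\<close>.  The operations below
  return the class of all morphisms having the defining universal property, so they need no choice
  of representatives; \<open>sub_le\<close> compares arbitrary representatives, all of which agree.\<close>

definition sub :: "('o, 'a) precategory \<Rightarrow> 'a set \<Rightarrow> 'o \<Rightarrow> 'a set set" where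
  "sub C M X = M_over C M X // sub_iso C M X"

definition sub_le :: "('o, 'a) precategory \<Rightarrow> 'a set \<Rightarrow> 'a set \<Rightarrow> bool" where
  "sub_le C a b \<longleftrightarrow> (\<exists>n \<in> a. \<exists>m \<in> b. \<exists>j \<in> hom C (Dom C n) (Dom C m). m \<cdot>\<^bsub>C\<^esub> j = n)"

definition sub_image ::
  "('o, 'a) precategory \<Rightarrow> 'a set \<Rightarrow> 'a set \<Rightarrow> 'a \<Rightarrow> 'a set \<Rightarrow> 'a set" where
  "sub_image C E M f a = {n \<in> M. Cod C n = Cod C f \<and>
    (\<exists>m \<in> a. \<exists>e \<in> E. Dom C e = Dom C m \<and> Cod C e = Dom C n \<and> f \<cdot>\<^bsub>C\<^esub> m = n \<cdot>\<^bsub>C\<^esub> e)}"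

definition sub_preimage :: "('o, 'a) precategory \<Rightarrow> 'a \<Rightarrow> 'a set \<Rightarrow> 'a set" where
  "sub_preimage C f b = {n'. \<exists>n \<in> b. \<exists>f'. is_pullback C f n n' f'}"

text \<open>The meet of a set \<open>N\<close> of subobjects of \<open>X\<close>; intersecting all representatives
  at once is the same as intersecting one representative of each class.\<close>

definition sub_meet :: "('o, 'a) precategory \<Rightarrow> 'o \<Rightarrow> 'a set set \<Rightarrow> 'a set" where
  "sub_meet C X N = {m. is_intersection C X (\<Union>N) m}"

type_synonym 'a sub_rel = "('a set \<times> 'a set) set"

definition T1 :: "('o, 'a) precategory \<Rightarrow> 'a sub_rel \<Rightarrow> bool" where
  "T1 C r \<longleftrightarrow> (\<forall>m n. (m, n) \<in> r \<longrightarrow> sub_le C m n)"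

definition T2 :: "('o, 'a) precategory \<Rightarrow> 'a set \<Rightarrow> 'o \<Rightarrow> 'a sub_rel \<Rightarrow> bool" where
  "T2 C M X r \<longleftrightarrow> (\<forall>m \<in> sub C M X. \<forall>n \<in> sub C M X. \<forall>p \<in> sub C M X. \<forall>q \<in> sub C M X.
    sub_le C m n \<and> (n, p) \<in> r \<and> sub_le C p q \<longrightarrow> (m, q) \<in> r)"

definition T3 :: "('o, 'a) precategory \<Rightarrow> ('o \<Rightarrow> 'a sub_rel) \<Rightarrow> bool" where
  "T3 C R \<longleftrightarrow> (\<forall>f \<in> Ar C. \<forall>m n. (m, n) \<in> R (Cod C f) \<longrightarrow>
    (sub_preimage C f m, sub_preimage C f n) \<in> R (Dom C f))"

definition topogenous_order ::
  "('o, 'a) precategory \<Rightarrow> 'a set \<Rightarrow> ('o \<Rightarrow> 'a sub_rel) \<Rightarrow> bool" where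
  "topogenous_order C M R \<longleftrightarrow>
    (\<forall>X \<in> Ob C. R X \<subseteq> sub C M X \<times> sub C M X \<and> T1 C (R X) \<and> T2 C M X (R X)) \<and> T3 C R"

definition interpolates :: "('o, 'a) precategory \<Rightarrow> 'a set \<Rightarrow> 'o \<Rightarrow> 'a sub_rel \<Rightarrow> bool" where
  "interpolates C M X r \<longleftrightarrow>
    (\<forall>m n. (m, n) \<in> r \<longrightarrow> (\<exists>p \<in> sub C M X. (m, p) \<in> r \<and> (p, n) \<in> r))"

definition meet_preserving :: "('o, 'a) precategory \<Rightarrow> 'a set \<Rightarrow> 'o \<Rightarrow> 'a sub_rel \<Rightarrow> bool" where
  "meet_preserving C M X r \<longleftrightarrow> (\<forall>m \<in> sub C M X. \<forall>N. N \<subseteq> sub C M X \<longrightarrow>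
    (\<forall>n \<in> N. (m, n) \<in> r) \<longrightarrow> (m, sub_meet C X N) \<in> r)"

text \<open>As usual, a directed set is non-empty.\<close>

definition directed :: "'b set set \<Rightarrow> bool" where
  "directed D \<longleftrightarrow> D \<noteq> {} \<and> (\<forall>r \<in> D. \<forall>s \<in> D. \<exists>t \<in> D. r \<subseteq> t \<and> s \<subseteq> t)"

definition syntopogenous_structure ::
  "('o, 'a) precategory \<Rightarrow> 'a set \<Rightarrow> ('o \<Rightarrow> 'a sub_rel set) \<Rightarrow> bool" where
  "syntopogenous_structure C M S \<longleftrightarrow>
    (\<forall>X \<in> Ob C. \<forall>r \<in> S X. r \<subseteq> sub C M X \<times> sub C M X \<and> T1 C r \<and> T2 C M X r) \<and>
    (\<forall>X \<in> Ob C. directed (S X)) \<and>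
    topogenous_order C M (\<lambda>X. \<Union>(S X)) \<and>
    (\<forall>X \<in> Ob C. interpolates C M X (\<Union>(S X)))"

definition syntop_le ::
  "('o, 'a) precategory \<Rightarrow> ('o \<Rightarrow> 'a sub_rel set) \<Rightarrow> ('o \<Rightarrow> 'a sub_rel set) \<Rightarrow> bool" where
  "syntop_le C S S' \<longleftrightarrow> (\<forall>X \<in> Ob C. \<forall>r \<in> S X. \<exists>r' \<in> S' X. r \<subseteq> r')"

definition interpolative ::
  "('o, 'a) precategory \<Rightarrow> 'a set \<Rightarrow> ('o \<Rightarrow> 'a sub_rel set) \<Rightarrow> bool" where
  "interpolative C M S \<longleftrightarrow> (\<forall>X \<in> Ob C. \<forall>r \<in> S X. interpolates C M X r)"

definition co_perfect ::
  "('o, 'a) precategory \<Rightarrow> 'a set \<Rightarrow> ('o \<Rightarrow> 'a sub_rel set) \<Rightarrow> bool" where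
  "co_perfect C M S \<longleftrightarrow> (\<forall>X \<in> Ob C. \<forall>r \<in> S X. meet_preserving C M X r)"

definition syntop_continuous ::
  "('o, 'a) precategory \<Rightarrow> 'a set \<Rightarrow> 'a set \<Rightarrow>
    ('o \<Rightarrow> 'a sub_rel set) \<Rightarrow> ('o \<Rightarrow> 'a sub_rel set) \<Rightarrow> 'a \<Rightarrow> bool" where
  "syntop_continuous C E M S S' f \<longleftrightarrow> (\<forall>r' \<in> S' (Cod C f). \<exists>r \<in> S (Dom C f).
    \<forall>m \<in> sub C M (Dom C f). \<forall>n \<in> sub C M (Cod C f).
      (sub_image C E M f m, n) \<in> r' \<longrightarrow> (m, sub_preimage C f n) \<in> r)"

locale pointed_endofunctor = category C
  for C :: "('o, 'a) precategory" (structure) +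
  fixes Fo :: "'o \<Rightarrow> 'o" and Fa :: "'a \<Rightarrow> 'a" and \<eta> :: "'o \<Rightarrow> 'a"
  assumes Fo_in_Ob: "X \<in> Ob C \<Longrightarrow> Fo X \<in> Ob C"
    and Fa_in_hom: "f \<in> hom C X Y \<Longrightarrow> Fa f \<in> hom C (Fo X) (Fo Y)"
    and Fa_id: "X \<in> Ob C \<Longrightarrow> Fa (Id C X) = Id C (Fo X)"
    and Fa_comp: "f \<in> hom C X Y \<Longrightarrow> g \<in> hom C Y Z \<Longrightarrow> Fa (g \<cdot> f) = Fa g \<cdot> Fa f"
    and eta_in_hom: "X \<in> Ob C \<Longrightarrow> \<eta> X \<in> hom C X (Fo X)"
    and eta_natural: "f \<in> hom C X Y \<Longrightarrow> Fa f \<cdot> \<eta> X = \<eta> Y \<cdot> f"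

locale E_pointed_endofunctor = pointed_endofunctor C Fo Fa \<eta>
  for C :: "('o, 'a) precategory" (structure) and E :: "'a set"
    and Fo :: "'o \<Rightarrow> 'o" and Fa :: "'a \<Rightarrow> 'a" and \<eta> :: "'o \<Rightarrow> 'a" +
  assumes eta_in_E: "X \<in> Ob C \<Longrightarrow> \<eta> X \<in> E"

definition eta_rel ::
  "('o, 'a) precategory \<Rightarrow> 'a set \<Rightarrow> 'a set \<Rightarrow> ('o \<Rightarrow> 'o) \<Rightarrow> ('o \<Rightarrow> 'a) \<Rightarrow> 'o \<Rightarrow>
    'a sub_rel \<Rightarrow> 'a sub_rel" where
  "eta_rel C E M Fo \<eta> X r = {(m, n). m \<in> sub C M X \<and> n \<in> sub C M X \<and>
    (\<exists>p \<in> sub C M (Fo X).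
      (sub_image C E M (\<eta> X) m, p) \<in> r \<and> sub_le C (sub_preimage C (\<eta> X) p) n)}"

definition eta_syntop ::
  "('o, 'a) precategory \<Rightarrow> 'a set \<Rightarrow> 'a set \<Rightarrow> ('o \<Rightarrow> 'o) \<Rightarrow> ('o \<Rightarrow> 'a) \<Rightarrow>
    ('o \<Rightarrow> 'a sub_rel set) \<Rightarrow> ('o \<Rightarrow> 'a sub_rel set)" where
  "eta_syntop C E M Fo \<eta> S X = eta_rel C E M Fo \<eta> X ` S (Fo X)"

end

theory Submission
  imports Defs
begin

text \<open>The proof rests on the adjunction \<open>f(m) \<le> n \<longleftrightarrow> m \<le> f\<^sup>-\<^sup>1(n)\<close> and the functoriality
  of inverse images.  A relation \<open>m \<sqsubset> n\<close> on \<open>FX\<close> is transported to \<open>X\<close> through a witness \<open>p\<close> with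
  \<open>\<eta>(m) \<sqsubset> p\<close>, and the witness is what is manipulated: an interpolant \<open>q\<close> between \<open>\<eta>(m)\<close> and
  \<open>p\<close> gives the interpolant \<open>\<eta>\<^sup>-\<^sup>1(q)\<close> because \<open>\<eta>(\<eta>\<^sup>-\<^sup>1(q)) \<le> q\<close>, the meet of the witnesses is a
  witness for the meet, and naturality of \<open>\<eta>\<close> makes \<open>(Ff)\<^sup>-\<^sup>1(p)\<close> a witness for the inverse
  images along \<open>f\<close>.\<close>

text \<open>The order on representatives, extended to arbitrary arrows \<open>t\<close> in place of
  members of \<open>M\<close>. Arrows \<open>t\<close> thus serve as generalized elements, against
  which pullbacks and intersections are tested.\<close>

definition factors_through :: "('o, 'a) precategory \<Rightarrow> 'a \<Rightarrow> 'a \<Rightarrow> bool" where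
  "factors_through C t n \<longleftrightarrow> (\<exists>j \<in> hom C (Dom C t) (Dom C n). n \<cdot>\<^bsub>C\<^esub> j = t)"

lemma hom_iff: "f \<in> hom C X Y \<longleftrightarrow> f \<in> Ar C \<and> Dom C f = X \<and> Cod C f = Y"
  by (simp add: hom_def)

section \<open>Composition and factorization in a category\<close>

context category
begin

lemma comp_Ar:
  assumes "f \<in> Ar C" "g \<in> Ar C" "Dom C g = Cod C f"
  shows "g \<cdot> f \<in> Ar C" "Dom C (g \<cdot> f) = Dom C f" "Cod C (g \<cdot> f) = Cod C g"
  using comp_in_hom[of f "Dom C f" "Cod C f" g "Cod C g"] assms by (auto simp: hom_iff)

lemma comp_assoc_Ar:
  assumes "f \<in> Ar C" "g \<in> Ar C" "h \<in> Ar C" "Dom C g = Cod C f" "Dom C h = Cod C g"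
  shows "h \<cdot> (g \<cdot> f) = (h \<cdot> g) \<cdot> f"
  using comp_assoc[of f "Dom C f" "Cod C f" g "Cod C g" h "Cod C h"] assms by (auto simp: hom_iff)

lemma factors_through_refl:
  assumes "t \<in> Ar C" shows "factors_through C t t"
  using assms comp_id_right[of t] id_in_hom[OF dom_in_Ob[OF assms]]
  by (auto simp: factors_through_def hom_iff)

lemma factors_through_comp:
  assumes "n \<in> Ar C" "v \<in> Ar C" "Cod C v = Dom C n"
  shows "factors_through C (n \<cdot> v) n"
  using assms comp_Ar[of v n] by (auto simp: factors_through_def hom_iff)

lemma factors_throughE:
  assumes "factors_through C t n"
  obtains j where "j \<in> Ar C" "Dom C j = Dom C t" "Cod C j = Dom C n" "n \<cdot> j = t"
  using assms by (auto simp: factors_through_def hom_iff)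

lemma factors_through_trans:
  assumes "factors_through C s t" "factors_through C t n" "n \<in> Ar C"
  shows "factors_through C s n"
proof -
  obtain j where j: "j \<in> Ar C" "Dom C j = Dom C s" "Cod C j = Dom C t" "t \<cdot> j = s"
    using assms(1) by (rule factors_throughE)
  obtain k where k: "k \<in> Ar C" "Dom C k = Dom C t" "Cod C k = Dom C n" "n \<cdot> k = t"
    using assms(2) by (rule factors_throughE)
  have "n \<cdot> (k \<cdot> j) = s"
    using comp_assoc_Ar[of j k n] j k assms(3) by simp
  then show ?thesis
    using factors_through_comp[of n "k \<cdot> j"] comp_Ar[of j k] j k assms(3) by simp
qed

lemma factors_through_comp_right:
  assumes "factors_through C s t" "t \<in> Ar C" "g \<in> Ar C" "Dom C g = Cod C t"
  shows "factors_through C (g \<cdot> s) (g \<cdot> t)"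
proof -
  obtain j where j: "j \<in> Ar C" "Dom C j = Dom C s" "Cod C j = Dom C t" "t \<cdot> j = s"
    using assms(1) by (rule factors_throughE)
  have "g \<cdot> s = (g \<cdot> t) \<cdot> j"
    using comp_assoc_Ar[of j t g] j assms by simp
  then show ?thesis
    using factors_through_comp[of "g \<cdot> t" j] comp_Ar[of t g] j assms by simp
qed

end

lemma sub_le_iff_factors: "sub_le C a b \<longleftrightarrow> (\<exists>n \<in> a. \<exists>m \<in> b. factors_through C n m)"
  by (simp add: sub_le_def factors_through_def)

lemma (in category) mono_cancel:
  assumes "mono_ar C m" "g \<in> Ar C" "h \<in> Ar C" "Dom C g = Dom C h"
    "Cod C g = Dom C m" "Cod C h = Dom C m" "m \<cdot> g = m \<cdot> h"
  shows "g = h"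
  using assms unfolding mono_ar_def by (auto simp: hom_iff)

section \<open>Subobjects and their order through representatives\<close>

context M_complete_category
begin

lemma M_over_iff: "m \<in> M_over C M X \<longleftrightarrow> m \<in> M \<and> Cod C m = X"
  by (auto simp: M_over_def)

lemma M_Ar: "m \<in> M \<Longrightarrow> m \<in> Ar C"
  using M_mono by (auto simp: mono_ar_def)

lemma E_Ar: "e \<in> E \<Longrightarrow> e \<in> Ar C"
  using E_epi by (auto simp: epi_ar_def)

text \<open>The two comparison arrows are mutually inverse: composing either round trip with the
  monomorphism \<open>m\<close> or \<open>n\<close> gives that monomorphism back, and cancelling it
  leaves an identity.\<close>

lemma sub_isoI:
  assumes m: "m \<in> M_over C M X" and n: "n \<in> M_over C M X"
    and le: "factors_through C m n" "factors_through C n m"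
  obtains h where "h \<in> hom C (Dom C m) (Dom C n)" "iso_ar C h" "n \<cdot> h = m"
proof -
  have Ar: "m \<in> Ar C" "n \<in> Ar C" and mono: "mono_ar C m" "mono_ar C n"
    using m n M_Ar M_mono by (auto simp: M_over_iff)
  obtain h where h: "h \<in> Ar C" "Dom C h = Dom C m" "Cod C h = Dom C n" "n \<cdot> h = m"
    using le(1) by (rule factors_throughE)
  obtain k where k: "k \<in> Ar C" "Dom C k = Dom C n" "Cod C k = Dom C m" "m \<cdot> k = n"
    using le(2) by (rule factors_throughE)
  have idm: "Id C (Dom C m) \<in> Ar C" "Dom C (Id C (Dom C m)) = Dom C m"
      "Cod C (Id C (Dom C m)) = Dom C m" "m \<cdot> Id C (Dom C m) = m"
    using id_in_hom[OF dom_in_Ob[OF Ar(1)]] comp_id_right[of m "Dom C m" "Cod C m"] Ar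
    by (auto simp: hom_iff)
  have idn: "Id C (Dom C n) \<in> Ar C" "Dom C (Id C (Dom C n)) = Dom C n"
      "Cod C (Id C (Dom C n)) = Dom C n" "n \<cdot> Id C (Dom C n) = n"
    using id_in_hom[OF dom_in_Ob[OF Ar(2)]] comp_id_right[of n "Dom C n" "Cod C n"] Ar
    by (auto simp: hom_iff)
  have "m \<cdot> (k \<cdot> h) = m" "n \<cdot> (h \<cdot> k) = n"
    using comp_assoc_Ar[of h k m] comp_assoc_Ar[of k h n] h k Ar by simp_all
  then have "k \<cdot> h = Id C (Dom C m)" "h \<cdot> k = Id C (Dom C n)"
    using mono_cancel[OF mono(1), of "k \<cdot> h" "Id C (Dom C m)"]
      mono_cancel[OF mono(2), of "h \<cdot> k" "Id C (Dom C n)"]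
      comp_Ar[of h k] comp_Ar[of k h] h k idm idn by simp_all
  then have "iso_ar C h"
    using h k by (auto simp: iso_ar_def hom_iff)
  then show thesis using that h by (auto simp: hom_iff)
qed

text \<open>Isomorphism of subobjects becomes the symmetric part of a preorder, so that later
  arguments need only factorizations and never an explicit inverse.\<close>

lemma sub_iso_iff: "(m, n) \<in> sub_iso C M X \<longleftrightarrow>
  m \<in> M_over C M X \<and> n \<in> M_over C M X \<and> factors_through C m n \<and> factors_through C n m"
  (is "_ \<longleftrightarrow> ?R")
proof
  assume "(m, n) \<in> sub_iso C M X"
  then obtain h where m: "m \<in> M_over C M X" and n: "n \<in> M_over C M X"
    and h: "h \<in> hom C (Dom C m) (Dom C n)" "iso_ar C h" "n \<cdot> h = m"
    by (auto simp: sub_iso_def)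
  obtain k where k: "k \<in> hom C (Dom C n) (Dom C m)" "h \<cdot> k = Id C (Dom C n)"
    using h by (auto simp: iso_ar_def hom_iff)
  have Ar: "n \<in> Ar C" using n M_Ar by (auto simp: M_over_iff)
  have "m \<cdot> k = n"
    using comp_assoc_Ar[of k h n] comp_id_right[of n "Dom C n" "Cod C n"] h k Ar
    by (auto simp: hom_iff)
  then show ?R
    using m n h k by (auto simp: factors_through_def)
next
  assume R: ?R
  then obtain h where "h \<in> hom C (Dom C m) (Dom C n)" "iso_ar C h" "n \<cdot> h = m"
    using sub_isoI by blast
  then show "(m, n) \<in> sub_iso C M X"
    using R by (auto simp: sub_iso_def)
qed

lemma equiv_sub_iso: "equiv (M_over C M X) (sub_iso C M X)"
proof (rule equivI)
  show "sub_iso C M X \<subseteq> M_over C M X \<times> M_over C M X"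
    by (auto simp: sub_iso_iff)
  show "refl_on (M_over C M X) (sub_iso C M X)"
    using factors_through_refl M_Ar by (auto simp: refl_on_def sub_iso_iff M_over_iff)
  show "sym (sub_iso C M X)"
    by (auto simp: sym_def sub_iso_iff)
  show "trans (sub_iso C M X)"
    using factors_through_trans M_Ar by (auto simp: trans_def sub_iso_iff M_over_iff)
qed

lemma sub_memD:
  assumes "a \<in> sub C M X" "m \<in> a"
  shows "m \<in> M" "m \<in> Ar C" "Cod C m = X"
proof -
  have "m \<in> M_over C M X"
    using assms in_quotient_imp_subset[OF equiv_sub_iso] unfolding sub_def by blast
  then show "m \<in> M" "m \<in> Ar C" "Cod C m = X"
    using M_Ar by (auto simp: M_over_iff)
qed

lemma sub_nonempty:
  assumes "a \<in> sub C M X" obtains m where "m \<in> a"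
  using assms in_quotient_imp_non_empty[OF equiv_sub_iso] by (auto simp: sub_def)

lemma sub_mem_factors:
  assumes "a \<in> sub C M X" "m \<in> a" "n \<in> a" shows "factors_through C m n"
  using quotient_eq_iff[OF equiv_sub_iso, of a X a m n] assms by (auto simp: sub_def sub_iso_iff)

text \<open>The last assumption identifies \<open>a\<close> with the \<open>sub_iso\<close> class of
  \<open>x\<close>. Inverse images, images and meets are all shown to be subobjects in this way,
  since each is defined as a full class of arrows.\<close>

lemma subI:
  assumes "x \<in> a" and "a \<subseteq> M_over C M X"
    and "\<And>n. n \<in> M_over C M X \<Longrightarrow> n \<in> a \<longleftrightarrow> factors_through C x n \<and> factors_through C n x"
  shows "a \<in> sub C M X"
proof -
  have "a = sub_iso C M X `` {x}"
    using assms by (fastforce simp: sub_iso_iff Image_singleton)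
  then show ?thesis
    using assms(1,2) by (auto simp: sub_def intro: quotientI)
qed

text \<open>Members of one class factor through each other, so the existential representatives in
  \<open>sub_le\<close> can be exchanged for any given ones.\<close>

lemma sub_le_iff:
  assumes "a \<in> sub C M X" "b \<in> sub C M X" "m \<in> a" "n \<in> b"
  shows "sub_le C a b \<longleftrightarrow> factors_through C m n"
proof
  assume "sub_le C a b"
  then obtain m' n' where mn: "m' \<in> a" "n' \<in> b" "factors_through C m' n'"
    by (auto simp: sub_le_iff_factors)
  have "factors_through C m m'" "factors_through C n' n"
    using sub_mem_factors assms mn by blast+
  then show "factors_through C m n"
    using mn(3) sub_memD(2)[OF assms(2)] assms(4) mn(2) factors_through_trans by blast
qed (use assms in \<open>auto simp: sub_le_iff_factors\<close>)

lemma sub_le_refl: "a \<in> sub C M X \<Longrightarrow> sub_le C a a"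
  by (metis sub_nonempty sub_le_iff sub_mem_factors)

lemma sub_le_trans:
  assumes "a \<in> sub C M X" "b \<in> sub C M X" "c \<in> sub C M X" "sub_le C a b" "sub_le C b c"
  shows "sub_le C a c"
proof -
  obtain l m n where mem: "l \<in> a" "m \<in> b" "n \<in> c"
    using assms(1-3) sub_nonempty by metis
  have "factors_through C l m" "factors_through C m n"
    using assms mem sub_le_iff by blast+
  then have "factors_through C l n"
    using factors_through_trans sub_memD(2)[OF assms(3) mem(3)] by blast
  then show ?thesis
    using sub_le_iff assms(1,3) mem by blast
qed

section \<open>Images, pullbacks and intersections as factorization conditions\<close>

lemma factors_through_image_iff:
  assumes t: "t \<in> Ar C" and n: "n \<in> M" and e: "e \<in> E" "Cod C e = Dom C n" "t = n \<cdot> e"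
    and p: "p \<in> M" "Cod C p = Cod C t"
  shows "factors_through C n p \<longleftrightarrow> factors_through C t p"
proof
  have ar: "n \<in> Ar C" "e \<in> Ar C" "p \<in> Ar C" using n e p M_Ar E_Ar by auto
  assume "factors_through C n p"
  then show "factors_through C t p"
    using factors_through_trans factors_through_comp ar e by metis
next
  have ar: "n \<in> Ar C" "e \<in> Ar C" "p \<in> Ar C" using n e p M_Ar E_Ar by auto
  have nt: "Dom C t = Dom C e" "Cod C t = Cod C n" using comp_Ar[of e n] ar e by auto
  assume "factors_through C t p"
  then obtain u where u: "u \<in> Ar C" "Dom C u = Dom C t" "Cod C u = Dom C p" "p \<cdot> u = t"
    by (rule factors_throughE)
  \<comment> \<open>The square \<open>p \<cdot> u = n \<cdot> e\<close> has \<open>e\<close> in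
    \<open>E\<close> and \<open>p\<close> in \<open>M\<close>; its diagonal is the factorization of
    \<open>n\<close> through \<open>p\<close>. Hence \<open>n\<close> is least among the members of
    \<open>M\<close> through which \<open>t\<close> factors.\<close>
  have "\<exists>!d. d \<in> hom C (Cod C e) (Dom C p) \<and> d \<cdot> e = u \<and> p \<cdot> d = n"
    by (rule diagonal) (use ar e p u nt in \<open>auto simp: hom_iff\<close>)
  then show "factors_through C n p"
    using e by (auto simp: factors_through_def)
qed

text \<open>A cone over the pullback with first leg \<open>t\<close> is the same as a factorization
  of \<open>f \<cdot> t\<close> through \<open>n\<close>, so the universal property can be read off
  from the first leg alone.\<close>

lemma is_pullback_factors:
  assumes n: "n \<in> M" and pb: "is_pullback C f n n' f'" and t: "t \<in> Ar C" "Cod C t = Dom C f"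
  shows "factors_through C t n' \<longleftrightarrow> factors_through C (f \<cdot> t) n"
proof -
  have pb': "f \<in> Ar C" "n \<in> Ar C" "n' \<in> Ar C" "f' \<in> Ar C" "Cod C f = Cod C n"
    "Dom C n' = Dom C f'" "Cod C n' = Dom C f" "Cod C f' = Dom C n" "f \<cdot> n' = n \<cdot> f'"
    using pb by (auto simp: is_pullback_def)
  show ?thesis
  proof
    assume "factors_through C t n'"
    then have "factors_through C (f \<cdot> t) (n \<cdot> f')"
      using factors_through_comp_right[of t n' f] pb' by simp
    then show "factors_through C (f \<cdot> t) n"
      using factors_through_trans factors_through_comp pb' by metis
  next
    assume "factors_through C (f \<cdot> t) n"
    then obtain v where v: "v \<in> hom C (Dom C t) (Dom C n)" "n \<cdot> v = f \<cdot> t"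
      using comp_Ar[of t f] t pb' by (auto simp: factors_through_def)
    moreover have "t \<in> hom C (Dom C t) (Dom C f)"
      using t by (simp add: hom_iff)
    ultimately have "\<exists>w. w \<in> hom C (Dom C t) (Dom C n') \<and> n' \<cdot> w = t"
      using pb unfolding is_pullback_def by metis
    then show "factors_through C t n'"
      by (auto simp: factors_through_def)
  qed
qed

text \<open>The condition on \<open>t\<close> yields existence, and monicity supplies the rest: that
  of \<open>n\<close> makes the second leg commute, that of \<open>n'\<close> makes the mediating
  arrow unique.\<close>

lemma is_pullbackI:
  assumes n: "n \<in> M" and n': "n' \<in> M" "Cod C n' = Dom C f" and f: "f \<in> Ar C" "Cod C f = Cod C n"
    and fact: "\<And>t. t \<in> Ar C \<Longrightarrow> Cod C t = Dom C f \<Longrightarrow>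
      factors_through C t n' \<longleftrightarrow> factors_through C (f \<cdot> t) n"
  shows "\<exists>f'. is_pullback C f n n' f'"
proof -
  have ar: "n \<in> Ar C" "n' \<in> Ar C" using n n' M_Ar by auto
  \<comment> \<open>Testing the condition at \<open>n'\<close> itself produces the missing leg
    \<open>f'\<close> of the square.\<close>
  have "factors_through C (f \<cdot> n') n"
    using fact ar n' factors_through_refl by auto
  then obtain f' where f': "f' \<in> Ar C" "Dom C f' = Dom C n'" "Cod C f' = Dom C n" "n \<cdot> f' = f \<cdot> n'"
    using comp_Ar[of n' f] ar n' f by (auto elim: factors_throughE)
  have "\<exists>!w. w \<in> hom C Z (Dom C n') \<and> n' \<cdot> w = u \<and> f' \<cdot> w = v"
    if u: "u \<in> hom C Z (Dom C f)" and v: "v \<in> hom C Z (Dom C n)" and uv: "f \<cdot> u = n \<cdot> v" for Z u v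
  proof -
    have "factors_through C (f \<cdot> u) n"
      using factors_through_comp[of n v] ar v uv by (auto simp: hom_iff)
    then have "factors_through C u n'"
      using fact u by (auto simp: hom_iff)
    then obtain w where w: "w \<in> hom C Z (Dom C n')" "n' \<cdot> w = u"
      using u by (auto simp: factors_through_def hom_iff)
    \<comment> \<open>Both sides equal \<open>f \<cdot> u\<close>.\<close>
    have "n \<cdot> (f' \<cdot> w) = n \<cdot> v"
      using comp_assoc_Ar[of w f' n] comp_assoc_Ar[of w n' f] w f' f ar n' uv
      by (auto simp: hom_iff)
    then have "f' \<cdot> w = v"
      using mono_cancel[OF M_mono[OF n], of "f' \<cdot> w" v] comp_Ar[of w f'] w f' v
      by (auto simp: hom_iff)
    moreover have "w' = w" if "w' \<in> hom C Z (Dom C n')" "n' \<cdot> w' = u" for w'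
      using mono_cancel[OF M_mono[OF n'(1)], of w' w] that w by (auto simp: hom_iff)
    ultimately show ?thesis using w by blast
  qed
  then have "is_pullback C f n n' f'"
    using ar n' f f' by (auto simp: is_pullback_def)
  then show ?thesis ..
qed

text \<open>Uniqueness of mediating arrows is automatic for a monic \<open>m\<close>, which leaves
  only a comparison of factorizations. For empty \<open>A\<close> the condition says that every
  arrow into \<open>X\<close> factors through \<open>m\<close>.\<close>

lemma is_intersection_iff:
  assumes A: "A \<subseteq> M_over C M X" and m: "m \<in> M" "Cod C m = X"
  shows "is_intersection C X A m \<longleftrightarrow>
    (\<forall>t \<in> Ar C. Cod C t = X \<longrightarrow>
      (factors_through C t m \<longleftrightarrow> (\<forall>n \<in> A. factors_through C t n)))"
  (is "_ \<longleftrightarrow> ?R")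
proof
  have ar: "m \<in> Ar C" "\<And>n. n \<in> A \<Longrightarrow> n \<in> Ar C" using A m M_Ar by (auto simp: M_over_iff)
  assume int: "is_intersection C X A m"
  then have le: "factors_through C m n" if "n \<in> A" for n
    using that by (auto simp: is_intersection_def factors_through_def)
  have "factors_through C t m"
    if t: "t \<in> Ar C" "Cod C t = X" "\<forall>n \<in> A. factors_through C t n" for t
  proof -
    have "t \<in> hom C (Dom C t) X"
      "\<forall>n\<in>A. \<exists>j\<in>hom C (Dom C t) (Dom C n). n \<cdot> j = t"
      using t by (auto simp: hom_iff factors_through_def)
    then have "\<exists>w. w \<in> hom C (Dom C t) (Dom C m) \<and> m \<cdot> w = t"
      using int unfolding is_intersection_def by metis
    then show ?thesis by (auto simp: factors_through_def)
  qed
  then show ?R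
    using le ar factors_through_trans by blast
next
  have ar: "m \<in> Ar C" using m M_Ar by auto
  assume R: ?R
  have le: "factors_through C m n" if "n \<in> A" for n
    using R that ar m factors_through_refl[OF ar] by auto
  have "\<exists>!w. w \<in> hom C Z (Dom C m) \<and> m \<cdot> w = t"
    if t: "t \<in> hom C Z X" "\<forall>n\<in>A. \<exists>j\<in>hom C Z (Dom C n). n \<cdot> j = t" for Z t
  proof -
    have "factors_through C t m"
      using R t by (auto simp: factors_through_def hom_iff)
    then obtain w where w: "w \<in> hom C Z (Dom C m)" "m \<cdot> w = t"
      using t by (auto simp: factors_through_def hom_iff)
    moreover have "w' = w" if "w' \<in> hom C Z (Dom C m)" "m \<cdot> w' = t" for w'
      using mono_cancel[OF M_mono[OF m(1)], of w' w] that w by (auto simp: hom_iff)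
    ultimately show ?thesis by blast
  qed
  then show "is_intersection C X A m"
    using le ar m by (auto simp: is_intersection_def factors_through_def)
qed

section \<open>Inverse images, images and meets of subobject classes\<close>

lemma sub_preimage_eq:
  assumes f: "f \<in> hom C X Y" and b: "b \<in> sub C M Y" and n: "n \<in> b"
  shows "sub_preimage C f b = {n' \<in> M_over C M X. \<forall>t \<in> Ar C. Cod C t = X \<longrightarrow>
    (factors_through C t n' \<longleftrightarrow> factors_through C (f \<cdot> t) n)}" (is "_ = ?R")
proof (intro set_eqI iffI)
  fix n' assume "n' \<in> sub_preimage C f b"
  then obtain p f' where p: "p \<in> b" "is_pullback C f p n' f'"
    by (auto simp: sub_preimage_def)
  then have n': "n' \<in> M" "Cod C n' = X"
    using pullback_in_M[OF sub_memD(1)[OF b p(1)] p(2)] f by (auto simp: is_pullback_def hom_iff)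
  \<comment> \<open>The representative \<open>p\<close> that was pulled back need not be
    \<open>n\<close>, but the two factor through each other, so the condition on \<open>t\<close> is
    the same.\<close>
  have "factors_through C (f \<cdot> t) p \<longleftrightarrow> factors_through C (f \<cdot> t) n" for t
    using factors_through_trans sub_mem_factors[OF b] sub_memD(2)[OF b] p(1) n by metis
  then show "n' \<in> ?R"
    using n' is_pullback_factors[OF sub_memD(1)[OF b p(1)] p(2)] f
    by (auto simp: M_over_iff hom_iff)
next
  fix n' assume "n' \<in> ?R"
  then have "\<exists>f'. is_pullback C f n n' f'"
    by (intro is_pullbackI) (use f sub_memD[OF b n] in \<open>auto simp: M_over_iff hom_iff\<close>)
  then show "n' \<in> sub_preimage C f b"
    using n by (auto simp: sub_preimage_def)
qed

lemma sub_preimage_in_sub: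
  assumes f: "f \<in> hom C X Y" and b: "b \<in> sub C M Y"
  shows "sub_preimage C f b \<in> sub C M X"
proof -
  obtain n where n: "n \<in> b" using b by (rule sub_nonempty)
  obtain n' f' where "is_pullback C f n n' f'"
    using pullback_exists[of n f] sub_memD[OF b n] f by (auto simp: hom_iff)
  then have n': "n' \<in> sub_preimage C f b"
    using n by (auto simp: sub_preimage_def)
  note eq = sub_preimage_eq[OF f b n]
  show ?thesis
  proof (rule subI[OF n'])
    show "sub_preimage C f b \<subseteq> M_over C M X"
      using eq by auto
    fix m assume m: "m \<in> M_over C M X"
    have ar: "m \<in> Ar C" "n' \<in> Ar C" "Cod C m = X" "Cod C n' = X"
      using m n' eq M_Ar by (auto simp: M_over_iff)
    have n'': "factors_through C t n' \<longleftrightarrow> factors_through C (f \<cdot> t) n"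
      if "t \<in> Ar C" "Cod C t = X" for t
      using n' eq that by auto
    have "m \<in> sub_preimage C f b \<longleftrightarrow>
      (\<forall>t \<in> Ar C. Cod C t = X \<longrightarrow> (factors_through C t m \<longleftrightarrow> factors_through C t n'))"
      using eq m n'' by auto
    \<comment> \<open>A Yoneda argument: testing at \<open>t = m\<close> and \<open>t = n'\<close>
      gives the two factorizations, and transitivity gives the converse.\<close>
    also have "\<dots> \<longleftrightarrow> factors_through C n' m \<and> factors_through C m n'"
      using ar factors_through_refl factors_through_trans by blast
    finally show "m \<in> sub_preimage C f b \<longleftrightarrow> factors_through C n' m \<and> factors_through C m n'" .
  qed
qed

text \<open>An image is determined by what lies above it, whereas an inverse image is determined by
  what lies below it. The test arrows \<open>p\<close> therefore range over
  \<open>M_over C M Y\<close> only, where the diagonal property applies.\<close>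

lemma sub_image_eq:
  assumes f: "f \<in> hom C X Y" and a: "a \<in> sub C M X" and m: "m \<in> a"
  shows "sub_image C E M f a = {n \<in> M_over C M Y. \<forall>p \<in> M_over C M Y.
    factors_through C n p \<longleftrightarrow> factors_through C (f \<cdot> m) p}" (is "_ = ?R")
proof (intro set_eqI iffI)
  note ma = sub_memD[OF a]
  fix n assume "n \<in> sub_image C E M f a"
  then obtain m' e where n: "n \<in> M" "Cod C n = Y" and m': "m' \<in> a"
    and e: "e \<in> E" "Cod C e = Dom C n" "f \<cdot> m' = n \<cdot> e"
    using f by (auto simp: sub_image_def hom_iff)
  have fm: "f \<cdot> m' \<in> Ar C" "Cod C (f \<cdot> m') = Y"
    using comp_Ar[of m' f] ma[OF m'] f by (auto simp: hom_iff)
  have "factors_through C (f \<cdot> m) (f \<cdot> m')" "factors_through C (f \<cdot> m') (f \<cdot> m)"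
    using factors_through_comp_right sub_mem_factors[OF a] ma m m' f by (auto simp: hom_iff)
  then have "factors_through C (f \<cdot> m) p \<longleftrightarrow> factors_through C (f \<cdot> m') p" if "p \<in> M" for p
    using factors_through_trans M_Ar that by metis
  then show "n \<in> ?R"
    using n factors_through_image_iff[OF fm(1) n(1) e] fm by (auto simp: M_over_iff)
next
  fix n assume n: "n \<in> ?R"
  have fm: "f \<cdot> m \<in> Ar C" "Cod C (f \<cdot> m) = Y" "Dom C (f \<cdot> m) = Dom C m"
    using comp_Ar[of m f] sub_memD[OF a m] f by (auto simp: hom_iff)
  \<comment> \<open>Some factorization of \<open>f \<cdot> m\<close> exists, through
    \<open>k\<close> say. As \<open>k\<close> and \<open>n\<close> lie below the same members of
    \<open>M\<close>, they are isomorphic; closure of \<open>E\<close> under composition with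
    isomorphisms then turns it into a factorization through the given \<open>n\<close>.\<close>
  obtain e k where k: "k \<in> M" "Cod C k = Y"
    and e: "e \<in> E" "Dom C e = Dom C m" "Cod C e = Dom C k" "f \<cdot> m = k \<cdot> e"
    using factorization[OF fm(1)] fm by auto
  have "factors_through C k p \<longleftrightarrow> factors_through C (f \<cdot> m) p" if "p \<in> M_over C M Y" for p
    using factors_through_image_iff[OF fm(1) k(1) e(1,3,4)] fm that by (auto simp: M_over_iff)
  then have "factors_through C k p \<longleftrightarrow> factors_through C n p" if "p \<in> M_over C M Y" for p
    using n that by auto
  then have "factors_through C k n" "factors_through C n k"
    using n k factors_through_refl M_Ar by (auto simp: M_over_iff)
  then obtain h where h: "h \<in> hom C (Dom C k) (Dom C n)" "iso_ar C h" "n \<cdot> h = k"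
    using n k sub_isoI[of k Y n] by (auto simp: M_over_iff)
  have "h \<cdot> e \<in> E" "Dom C (h \<cdot> e) = Dom C m" "Cod C (h \<cdot> e) = Dom C n"
    using E_iso_closed[of e h] comp_Ar[of e h] h e E_Ar by (auto simp: hom_iff)
  moreover have "f \<cdot> m = n \<cdot> (h \<cdot> e)"
    using comp_assoc_Ar[of e h n] h e E_Ar n M_Ar by (auto simp: hom_iff M_over_iff)
  ultimately show "n \<in> sub_image C E M f a"
    using n m f unfolding sub_image_def by (auto simp: M_over_iff hom_iff)
qed

lemma sub_image_in_sub:
  assumes f: "f \<in> hom C X Y" and a: "a \<in> sub C M X"
  shows "sub_image C E M f a \<in> sub C M Y"
proof -
  obtain m where m: "m \<in> a" using a by (rule sub_nonempty)
  have fm: "f \<cdot> m \<in> Ar C" "Cod C (f \<cdot> m) = Y" "Dom C (f \<cdot> m) = Dom C m"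
    using comp_Ar[of m f] sub_memD[OF a m] f by (auto simp: hom_iff)
  note eq = sub_image_eq[OF f a m]
  obtain e k where "k \<in> M" "Cod C k = Y"
    "e \<in> E" "Dom C e = Dom C m" "Cod C e = Dom C k" "f \<cdot> m = k \<cdot> e"
    using factorization[OF fm(1)] fm by auto
  then have k: "k \<in> sub_image C E M f a"
    using m f by (auto simp: sub_image_def hom_iff)
  show ?thesis
  proof (rule subI[OF k])
    show "sub_image C E M f a \<subseteq> M_over C M Y"
      using eq by auto
    fix n assume n: "n \<in> M_over C M Y"
    have kM: "k \<in> M_over C M Y" using k eq by auto
    have "n \<in> sub_image C E M f a \<longleftrightarrow>
      (\<forall>p \<in> M_over C M Y. factors_through C n p \<longleftrightarrow> factors_through C k p)"
      using eq k n by auto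
    also have "\<dots> \<longleftrightarrow> factors_through C k n \<and> factors_through C n k"
    proof
      assume "\<forall>p \<in> M_over C M Y. factors_through C n p \<longleftrightarrow> factors_through C k p"
      then show "factors_through C k n \<and> factors_through C n k"
        using n kM factors_through_refl M_Ar by (auto simp: M_over_iff)
    next
      assume "factors_through C k n \<and> factors_through C n k"
      then show "\<forall>p \<in> M_over C M Y. factors_through C n p \<longleftrightarrow> factors_through C k p"
        using factors_through_trans M_Ar by (metis M_over_iff)
    qed
    finally show "n \<in> sub_image C E M f a \<longleftrightarrow> factors_through C k n \<and> factors_through C n k" .
  qed
qed

text \<open>For representatives \<open>m\<close> of \<open>a\<close> and \<open>n\<close> of
  \<open>b\<close>, both sides say that \<open>f \<cdot> m\<close> factors through
  \<open>n\<close>.\<close>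

lemma image_le_iff_le_preimage:
  assumes f: "f \<in> hom C X Y" and a: "a \<in> sub C M X" and b: "b \<in> sub C M Y"
  shows "sub_le C (sub_image C E M f a) b \<longleftrightarrow> sub_le C a (sub_preimage C f b)"
proof -
  note I = sub_image_in_sub[OF f a] and P = sub_preimage_in_sub[OF f b]
  obtain m n i p where mem: "m \<in> a" "n \<in> b" "i \<in> sub_image C E M f a" "p \<in> sub_preimage C f b"
    using sub_nonempty a b I P by metis
  have "sub_le C (sub_image C E M f a) b \<longleftrightarrow> factors_through C i n"
    using sub_le_iff[OF I b] mem by simp
  also have "\<dots> \<longleftrightarrow> factors_through C (f \<cdot> m) n"
    using sub_image_eq[OF f a mem(1)] mem sub_memD[OF b] by (auto simp: M_over_iff)
  also have "\<dots> \<longleftrightarrow> factors_through C m p"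
    using sub_preimage_eq[OF f b mem(2)] mem sub_memD[OF a] by auto
  also have "\<dots> \<longleftrightarrow> sub_le C a (sub_preimage C f b)"
    using sub_le_iff[OF a P] mem by simp
  finally show ?thesis .
qed

text \<open>Equality of sets holds, and not only inequality in both directions, because each side
  consists of all members of \<open>M\<close> over \<open>X\<close> that satisfy one condition,
  namely the test whether \<open>(g \<cdot> f) \<cdot> t\<close> factors through
  \<open>n\<close>.\<close>

lemma sub_preimage_comp:
  assumes f: "f \<in> hom C X Y" and g: "g \<in> hom C Y Z" and c: "c \<in> sub C M Z"
  shows "sub_preimage C f (sub_preimage C g c) = sub_preimage C (g \<cdot> f) c"
proof -
  note P = sub_preimage_in_sub[OF g c]
  obtain n p where n: "n \<in> c" and p: "p \<in> sub_preimage C g c"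
    using sub_nonempty c P by metis
  have "factors_through C (f \<cdot> t) p \<longleftrightarrow> factors_through C ((g \<cdot> f) \<cdot> t) n"
    if t: "t \<in> Ar C" "Cod C t = X" for t
  proof -
    have "factors_through C (f \<cdot> t) p \<longleftrightarrow> factors_through C (g \<cdot> (f \<cdot> t)) n"
      using p comp_Ar[of t f] t f unfolding sub_preimage_eq[OF g c n] by (auto simp: hom_iff)
    then show ?thesis
      using comp_assoc_Ar[of t f g] t f g by (auto simp: hom_iff)
  qed
  then show ?thesis
    unfolding sub_preimage_eq[OF f P p] sub_preimage_eq[OF comp_in_hom[OF f g] c n] by auto
qed

lemma sub_meet_eq:
  assumes X: "X \<in> Ob C" and N: "N \<subseteq> sub C M X"
  shows "sub_meet C X N = {m \<in> M_over C M X. \<forall>t \<in> Ar C. Cod C t = X \<longrightarrow>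
    (factors_through C t m \<longleftrightarrow> (\<forall>n \<in> \<Union>N. factors_through C t n))}"
proof -
  have A: "\<Union>N \<subseteq> M_over C M X"
    using N sub_memD by (auto simp: M_over_iff)
  have "m \<in> M_over C M X" if "is_intersection C X (\<Union>N) m" for m
    using intersection_in_M[OF X A that] that by (auto simp: M_over_iff is_intersection_def)
  then show ?thesis
    using is_intersection_iff[OF A] unfolding sub_meet_def M_over_iff by blast
qed

lemma sub_meet_in_sub:
  assumes X: "X \<in> Ob C" and N: "N \<subseteq> sub C M X"
  shows "sub_meet C X N \<in> sub C M X"
proof -
  note eq = sub_meet_eq[OF X N]
  have "\<Union>N \<subseteq> M_over C M X"
    using N sub_memD by (auto simp: M_over_iff)
  then obtain k where k: "k \<in> sub_meet C X N"
    using intersection_exists[OF X, of "\<Union>N"] by (auto simp: sub_meet_def)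
  show ?thesis
  proof (rule subI[OF k])
    show "sub_meet C X N \<subseteq> M_over C M X"
      using eq by auto
    fix m assume m: "m \<in> M_over C M X"
    have ar: "m \<in> Ar C" "k \<in> Ar C" "Cod C m = X" "Cod C k = X"
      using m k eq M_Ar by (auto simp: M_over_iff)
    have k': "factors_through C t k \<longleftrightarrow> (\<forall>n \<in> \<Union>N. factors_through C t n)"
      if "t \<in> Ar C" "Cod C t = X" for t
      using k that unfolding eq by blast
    have "m \<in> sub_meet C X N \<longleftrightarrow>
      (\<forall>t \<in> Ar C. Cod C t = X \<longrightarrow> (factors_through C t m \<longleftrightarrow> factors_through C t k))"
      unfolding eq using m k' by simp
    also have "\<dots> \<longleftrightarrow> factors_through C k m \<and> factors_through C m k"
      using ar factors_through_refl factors_through_trans by blast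
    finally show "m \<in> sub_meet C X N \<longleftrightarrow> factors_through C k m \<and> factors_through C m k" .
  qed
qed

text \<open>The meet is taken over all representatives of all members of \<open>N\<close>. Within
  one class they impose equivalent conditions, so a single representative of each member
  decides.\<close>

lemma le_sub_meet_iff:
  assumes X: "X \<in> Ob C" and N: "N \<subseteq> sub C M X" and a: "a \<in> sub C M X"
  shows "sub_le C a (sub_meet C X N) \<longleftrightarrow> (\<forall>n \<in> N. sub_le C a n)"
proof -
  note I = sub_meet_in_sub[OF X N]
  obtain m k where mem: "m \<in> a" "k \<in> sub_meet C X N"
    using sub_nonempty a I by metis
  have "sub_le C a (sub_meet C X N) \<longleftrightarrow> factors_through C m k"
    using sub_le_iff[OF a I] mem by simp
  also have "\<dots> \<longleftrightarrow> (\<forall>n \<in> \<Union>N. factors_through C m n)"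
    using mem(2) sub_memD[OF a mem(1)] unfolding sub_meet_eq[OF X N] by blast
  also have "\<dots> \<longleftrightarrow> (\<forall>b \<in> N. \<forall>n \<in> b. factors_through C m n)"
    by auto
  also have "\<dots> \<longleftrightarrow> (\<forall>b \<in> N. sub_le C a b)"
  proof (rule ball_cong[OF refl])
    fix b assume "b \<in> N"
    then have b: "b \<in> sub C M X" using N by blast
    obtain n where "n \<in> b" using b by (rule sub_nonempty)
    then show "(\<forall>n \<in> b. factors_through C m n) \<longleftrightarrow> sub_le C a b"
      using sub_le_iff[OF a b mem(1)] by blast
  qed
  finally show ?thesis .
qed

section \<open>Monotonicity and counit from the adjunction\<close>

lemma sub_image_mono:
  assumes f: "f \<in> hom C X Y" and ab: "a \<in> sub C M X" "b \<in> sub C M X" "sub_le C a b"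
  shows "sub_le C (sub_image C E M f a) (sub_image C E M f b)"
proof -
  note I = sub_image_in_sub[OF f ab(2)]
  have "sub_le C b (sub_preimage C f (sub_image C E M f b))"
    using image_le_iff_le_preimage[OF f ab(2) I] sub_le_refl[OF I] by simp
  then show ?thesis
    using image_le_iff_le_preimage[OF f ab(1) I] sub_preimage_in_sub[OF f I] sub_le_trans ab by blast
qed

lemma image_preimage_le:
  assumes f: "f \<in> hom C X Y" and b: "b \<in> sub C M Y"
  shows "sub_le C (sub_image C E M f (sub_preimage C f b)) b"
  using image_le_iff_le_preimage[OF f _ b] sub_preimage_in_sub[OF f b] sub_le_refl by blast

lemma sub_preimage_mono:
  assumes f: "f \<in> hom C X Y" and ab: "a \<in> sub C M Y" "b \<in> sub C M Y" "sub_le C a b"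
  shows "sub_le C (sub_preimage C f a) (sub_preimage C f b)"
  using image_le_iff_le_preimage[OF f sub_preimage_in_sub[OF f ab(1)] ab(2)]
    image_preimage_le[OF f ab(1)] sub_image_in_sub[OF f sub_preimage_in_sub[OF f ab(1)]]
    sub_le_trans ab by blast

end

section \<open>Transport of relations along \<eta>\<close>

lemma T2D:
  assumes "T2 C M X r" "m \<in> sub C M X" "n \<in> sub C M X" "p \<in> sub C M X" "q \<in> sub C M X"
    "sub_le C m n" "(n, p) \<in> r" "sub_le C p q"
  shows "(m, q) \<in> r"
  using assms unfolding T2_def by blast

locale pointed_M_complete_category =
  M_complete_category C E M + pointed_endofunctor C Fo Fa \<eta>
  for C :: "('o, 'a) precategory" (structure) and E M :: "'a set"
    and Fo :: "'o \<Rightarrow> 'o" and Fa :: "'a \<Rightarrow> 'a" and \<eta> :: "'o \<Rightarrow> 'a"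
begin

lemma eta_relE:
  assumes "(m, n) \<in> eta_rel C E M Fo \<eta> X r"
  obtains p where "m \<in> sub C M X" "n \<in> sub C M X" "p \<in> sub C M (Fo X)"
    "(sub_image C E M (\<eta> X) m, p) \<in> r" "sub_le C (sub_preimage C (\<eta> X) p) n"
  using assms by (auto simp: eta_rel_def)

lemma eta_rel_mono: "r \<subseteq> s \<Longrightarrow> eta_rel C E M Fo \<eta> X r \<subseteq> eta_rel C E M Fo \<eta> X s"
  by (auto simp: eta_rel_def)

text \<open>A witness uses just one relation of the family, so transport commutes with unions. The
  topogenous and interpolation axioms for the whole family thereby reduce to statements about one
  transported relation per object.\<close>

lemma Union_eta_syntop: "\<Union>(eta_syntop C E M Fo \<eta> S X) = eta_rel C E M Fo \<eta> X (\<Union>(S (Fo X)))"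
  by (auto simp: eta_syntop_def eta_rel_def)

lemma eta_rel_subset: "eta_rel C E M Fo \<eta> X r \<subseteq> sub C M X \<times> sub C M X"
  by (auto simp: eta_rel_def)

text \<open>The subobject \<open>p\<close> is its own witness, by reflexivity. This is the form in
  which continuity of \<open>\<eta> X\<close> is used.\<close>

lemma eta_rel_preimage:
  assumes X: "X \<in> Ob C" and m: "m \<in> sub C M X" and p: "p \<in> sub C M (Fo X)"
    and r: "(sub_image C E M (\<eta> X) m, p) \<in> r"
  shows "(m, sub_preimage C (\<eta> X) p) \<in> eta_rel C E M Fo \<eta> X r"
  using sub_preimage_in_sub[OF eta_in_hom[OF X] p] sub_le_refl m p r by (auto simp: eta_rel_def)

text \<open>(T1) for \<open>r\<close> puts the image of \<open>m\<close> below the witness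
  \<open>p\<close>; transposing gives \<open>m\<close> below the inverse image of \<open>p\<close>,
  hence below \<open>n\<close>.\<close>

lemma T1_eta_rel:
  assumes X: "X \<in> Ob C" and T1: "T1 C r"
  shows "T1 C (eta_rel C E M Fo \<eta> X r)"
  unfolding T1_def
proof (intro allI impI)
  fix m n assume "(m, n) \<in> eta_rel C E M Fo \<eta> X r"
  then obtain p where p: "m \<in> sub C M X" "n \<in> sub C M X" "p \<in> sub C M (Fo X)"
    "(sub_image C E M (\<eta> X) m, p) \<in> r" "sub_le C (sub_preimage C (\<eta> X) p) n"
    by (rule eta_relE)
  have "sub_le C m (sub_preimage C (\<eta> X) p)"
    using image_le_iff_le_preimage[OF eta_in_hom[OF X] p(1,3)] T1 p(4) by (auto simp: T1_def)
  then show "sub_le C m n"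
    using sub_le_trans sub_preimage_in_sub[OF eta_in_hom[OF X] p(3)] p by blast
qed

lemma T2_eta_rel:
  assumes X: "X \<in> Ob C" and T2: "T2 C M (Fo X) r"
  shows "T2 C M X (eta_rel C E M Fo \<eta> X r)"
  unfolding T2_def
proof (intro ballI impI, elim conjE)
  note eta = eta_in_hom[OF X]
  fix m n k q
  assume mq: "m \<in> sub C M X" "q \<in> sub C M X" "sub_le C m n" "sub_le C k q"
    and "(n, k) \<in> eta_rel C E M Fo \<eta> X r"
  then obtain p where p: "n \<in> sub C M X" "k \<in> sub C M X" "p \<in> sub C M (Fo X)"
    "(sub_image C E M (\<eta> X) n, p) \<in> r" "sub_le C (sub_preimage C (\<eta> X) p) k"
    by (elim eta_relE)
  \<comment> \<open>The witness \<open>p\<close> is kept: monotonicity of images handles the smaller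
    left argument, transitivity the larger right one.\<close>
  have "(sub_image C E M (\<eta> X) m, p) \<in> r"
    using T2D[OF T2 _ _ _ _ sub_image_mono[OF eta mq(1) p(1) mq(3)] p(4)]
      sub_image_in_sub[OF eta] mq p sub_le_refl by blast
  moreover have "sub_le C (sub_preimage C (\<eta> X) p) q"
    using sub_le_trans sub_preimage_in_sub[OF eta p(3)] p mq by blast
  ultimately show "(m, q) \<in> eta_rel C E M Fo \<eta> X r"
    using mq p by (auto simp: eta_rel_def)
qed

lemma interpolates_eta_rel:
  assumes X: "X \<in> Ob C" and T2: "T2 C M (Fo X) r" and int: "interpolates C M (Fo X) r"
  shows "interpolates C M X (eta_rel C E M Fo \<eta> X r)"
  unfolding interpolates_def
proof (intro allI impI)
  note eta = eta_in_hom[OF X]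
  fix m n assume "(m, n) \<in> eta_rel C E M Fo \<eta> X r"
  then obtain p where p: "m \<in> sub C M X" "n \<in> sub C M X" "p \<in> sub C M (Fo X)"
    "(sub_image C E M (\<eta> X) m, p) \<in> r" "sub_le C (sub_preimage C (\<eta> X) p) n"
    by (rule eta_relE)
  obtain q where q: "q \<in> sub C M (Fo X)" "(sub_image C E M (\<eta> X) m, q) \<in> r" "(q, p) \<in> r"
    using int p(4) by (auto simp: interpolates_def)
  let ?q = "sub_preimage C (\<eta> X) q"
  have "?q \<in> sub C M X"
    using sub_preimage_in_sub[OF eta q(1)] .
  moreover have "(m, ?q) \<in> eta_rel C E M Fo \<eta> X r"
    using eta_rel_preimage X p q by blast
  \<comment> \<open>The counit places the image of \<open>?q\<close> below \<open>q\<close>, and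
    (T2) for \<open>r\<close> carries \<open>(q, p) \<in> r\<close> down to it. So \<open>p\<close>
    also witnesses the second half of the interpolation.\<close>
  moreover have "(sub_image C E M (\<eta> X) ?q, p) \<in> r"
    using T2D[OF T2 _ _ _ _ image_preimage_le[OF eta q(1)] q(3)] sub_image_in_sub[OF eta]
      calculation(1) p q sub_le_refl by blast
  ultimately show "\<exists>q \<in> sub C M X. (m, q) \<in> eta_rel C E M Fo \<eta> X r \<and> (q, n) \<in> eta_rel C E M Fo \<eta> X r"
    using p by (auto simp: eta_rel_def)
qed

lemma meet_preserving_eta_rel:
  assumes X: "X \<in> Ob C" and meet: "meet_preserving C M (Fo X) r"
  shows "meet_preserving C M X (eta_rel C E M Fo \<eta> X r)"
  unfolding meet_preserving_def
proof (intro ballI allI impI)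
  note eta = eta_in_hom[OF X] and FX = Fo_in_Ob[OF X]
  fix m N assume m: "m \<in> sub C M X" and N: "N \<subseteq> sub C M X"
    and mN: "\<forall>n \<in> N. (m, n) \<in> eta_rel C E M Fo \<eta> X r"
  let ?m = "sub_image C E M (\<eta> X) m"
  \<comment> \<open>All witnesses for \<open>m\<close> are collected, instead of one chosen for each
    \<open>n\<close> in \<open>N\<close>. This avoids choice, and further members can only make the
    meet smaller, which preserves the inequalities to be shown.\<close>
  define P where "P = {p \<in> sub C M (Fo X). (?m, p) \<in> r}"
  let ?p = "sub_meet C (Fo X) P"
  have P: "P \<subseteq> sub C M (Fo X)" by (auto simp: P_def)
  note p = sub_meet_in_sub[OF FX P] and pre = sub_preimage_in_sub[OF eta]
  have "(?m, ?p) \<in> r"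
    using meet sub_image_in_sub[OF eta m] P unfolding meet_preserving_def by (auto simp: P_def)
  moreover have "sub_le C (sub_preimage C (\<eta> X) ?p) n" if n: "n \<in> N" for n
  proof -
    obtain q where q: "q \<in> P" "sub_le C (sub_preimage C (\<eta> X) q) n"
      using mN n by (auto simp: P_def elim: eta_relE)
    have qs: "q \<in> sub C M (Fo X)" using P q by blast
    have "sub_le C ?p q"
      using le_sub_meet_iff[OF FX P p] sub_le_refl[OF p] q by blast
    then have "sub_le C (sub_preimage C (\<eta> X) ?p) (sub_preimage C (\<eta> X) q)"
      using sub_preimage_mono[OF eta p qs] by simp
    then show ?thesis
      using sub_le_trans[OF pre[OF p] pre[OF qs]] q n N by blast
  qed
  then have "sub_le C (sub_preimage C (\<eta> X) ?p) (sub_meet C X N)"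
    using le_sub_meet_iff[OF X N pre[OF p]] by simp
  ultimately show "(m, sub_meet C X N) \<in> eta_rel C E M Fo \<eta> X r"
    using m p sub_meet_in_sub[OF X N] by (auto simp: eta_rel_def)
qed

section \<open>Naturality and stability under inverse images\<close>

lemma preimage_eta_natural:
  assumes f: "f \<in> hom C X Y" and p: "p \<in> sub C M (Fo Y)"
  shows "sub_preimage C (\<eta> X) (sub_preimage C (Fa f) p) = sub_preimage C f (sub_preimage C (\<eta> Y) p)"
proof -
  have "X \<in> Ob C" "Y \<in> Ob C" using f dom_in_Ob cod_in_Ob by (auto simp: hom_iff)
  then show ?thesis
    \<comment> \<open>Functoriality of inverse images turns the two sides into inverse images along
      the two composites of the naturality square.\<close>
    using sub_preimage_comp[OF eta_in_hom Fa_in_hom[OF f] p]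
      sub_preimage_comp[OF f eta_in_hom p] eta_natural[OF f] by simp
qed

lemma topogenous_order_eta_rel:
  assumes R: "topogenous_order C M R"
  shows "topogenous_order C M (\<lambda>X. eta_rel C E M Fo \<eta> X (R (Fo X)))"
proof -
  have T12: "T1 C (R (Fo X))" "T2 C M (Fo X) (R (Fo X))" if "X \<in> Ob C" for X
    using R Fo_in_Ob[OF that] by (auto simp: topogenous_order_def)
  have "T3 C (\<lambda>X. eta_rel C E M Fo \<eta> X (R (Fo X)))"
    unfolding T3_def
  proof (intro ballI allI impI)
    fix f m n assume "f \<in> Ar C" and mn: "(m, n) \<in> eta_rel C E M Fo \<eta> (Cod C f) (R (Fo (Cod C f)))"
    define X Y where "X = Dom C f" and "Y = Cod C f"
    have f: "f \<in> hom C X Y" and X: "X \<in> Ob C" and Y: "Y \<in> Ob C"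
      using \<open>f \<in> Ar C\<close> dom_in_Ob cod_in_Ob by (auto simp: hom_iff X_def Y_def)
    note eX = eta_in_hom[OF X] and eY = eta_in_hom[OF Y] and Ff = Fa_in_hom[OF f]
    obtain p where p: "m \<in> sub C M Y" "n \<in> sub C M Y" "p \<in> sub C M (Fo Y)"
      "(sub_image C E M (\<eta> Y) m, p) \<in> R (Fo Y)" "sub_le C (sub_preimage C (\<eta> Y) p) n"
      using mn unfolding Y_def by (rule eta_relE)
    let ?m = "sub_image C E M (\<eta> Y) m"
    note im = sub_image_in_sub[OF eY p(1)]
    note fm = sub_preimage_in_sub[OF f p(1)] and fn = sub_preimage_in_sub[OF f p(2)]
    note Fm = sub_preimage_in_sub[OF Ff im] and Fp = sub_preimage_in_sub[OF Ff p(3)]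
    have "T3 C R" using R by (simp add: topogenous_order_def)
    then have Rp: "(sub_preimage C (Fa f) ?m, sub_preimage C (Fa f) p) \<in> R (Fo X)"
      using p(4) Ff unfolding T3_def by (auto simp: hom_iff)
    \<comment> \<open>The unit of the adjunction for \<open>\<eta> Y\<close>. Pulled back along
      \<open>f\<close>, rewritten by naturality and transposed along \<open>\<eta> X\<close>, it
      bounds the image of the inverse image of \<open>m\<close> by the inverse image of
      \<open>?m\<close> along \<open>Fa f\<close>; (T2) then replaces the left argument of
      \<open>Rp\<close>.\<close>
    have "sub_le C m (sub_preimage C (\<eta> Y) ?m)"
      using image_le_iff_le_preimage[OF eY p(1) im] sub_le_refl[OF im] by simp
    then have "sub_le C (sub_preimage C f m) (sub_preimage C (\<eta> X) (sub_preimage C (Fa f) ?m))"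
      using sub_preimage_mono[OF f p(1) sub_preimage_in_sub[OF eY im]] preimage_eta_natural[OF f im]
      by simp
    then have "sub_le C (sub_image C E M (\<eta> X) (sub_preimage C f m)) (sub_preimage C (Fa f) ?m)"
      using image_le_iff_le_preimage[OF eX fm Fm] by simp
    then have "(sub_image C E M (\<eta> X) (sub_preimage C f m), sub_preimage C (Fa f) p) \<in> R (Fo X)"
      using T2D[OF T12(2)[OF X] sub_image_in_sub[OF eX fm] Fm Fp Fp _ Rp sub_le_refl[OF Fp]] by simp
    \<comment> \<open>The inverse image of \<open>p\<close> along \<open>Fa f\<close> serves as the
      witness: by naturality, pulling it back along \<open>\<eta> X\<close> agrees with pulling back
      along \<open>\<eta> Y\<close> and then along \<open>f\<close>.\<close>
    moreover have
      "sub_le C (sub_preimage C (\<eta> X) (sub_preimage C (Fa f) p)) (sub_preimage C f n)"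
      using sub_preimage_mono[OF f sub_preimage_in_sub[OF eY p(3)] p(2,5)]
        preimage_eta_natural[OF f p(3)] by simp
    ultimately show "(sub_preimage C f m, sub_preimage C f n)
        \<in> eta_rel C E M Fo \<eta> (Dom C f) (R (Fo (Dom C f)))"
      using fm fn Fp unfolding X_def by (auto simp: eta_rel_def)
  qed
  then show ?thesis
    using T1_eta_rel T2_eta_rel T12 eta_rel_subset by (auto simp: topogenous_order_def)
qed

section \<open>The transported syntopogenous structure\<close>

lemma directed_eta_syntop:
  assumes "directed (S (Fo X))"
  shows "directed (eta_syntop C E M Fo \<eta> S X)"
proof -
  have "\<exists>t \<in> eta_syntop C E M Fo \<eta> S X. r \<subseteq> t \<and> s \<subseteq> t"
    if rs: "r \<in> eta_syntop C E M Fo \<eta> S X" "s \<in> eta_syntop C E M Fo \<eta> S X" for r s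
  proof -
    obtain r' s' where r': "r' \<in> S (Fo X)" "r = eta_rel C E M Fo \<eta> X r'"
      and s': "s' \<in> S (Fo X)" "s = eta_rel C E M Fo \<eta> X s'"
      using rs by (auto simp: eta_syntop_def)
    obtain t where "t \<in> S (Fo X)" "r' \<subseteq> t" "s' \<subseteq> t"
      using assms r' s' unfolding directed_def by blast
    \<comment> \<open>Transport is monotone in the relation, so it sends the upper bound
      \<open>t\<close> to an upper bound of \<open>r\<close> and \<open>s\<close>.\<close>
    then show ?thesis
      using r' s' eta_rel_mono[of r' t X] eta_rel_mono[of s' t X] by (auto simp: eta_syntop_def)
  qed
  moreover have "eta_syntop C E M Fo \<eta> S X \<noteq> {}"
    using assms by (simp add: directed_def eta_syntop_def)
  ultimately show ?thesis by (simp add: directed_def)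
qed

lemma syntopogenous_eta_syntop:
  assumes S: "syntopogenous_structure C M S"
  shows "syntopogenous_structure C M (eta_syntop C E M Fo \<eta> S)"
proof -
  have S1: "T1 C r" "T2 C M (Fo X) r" if "X \<in> Ob C" "r \<in> S (Fo X)" for X r
    using S that Fo_in_Ob by (auto simp: syntopogenous_structure_def)
  have topo: "topogenous_order C M (\<lambda>X. \<Union>(S X))"
    using S by (simp add: syntopogenous_structure_def)
  have "r \<subseteq> sub C M X \<times> sub C M X \<and> T1 C r \<and> T2 C M X r"
    if "X \<in> Ob C" "r \<in> eta_syntop C E M Fo \<eta> S X" for X r
    using that S1 T1_eta_rel T2_eta_rel eta_rel_subset unfolding eta_syntop_def by blast
  moreover have "directed (eta_syntop C E M Fo \<eta> S X)" if "X \<in> Ob C" for X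
    using directed_eta_syntop S Fo_in_Ob[OF that] by (auto simp: syntopogenous_structure_def)
  moreover have "topogenous_order C M (\<lambda>X. \<Union>(eta_syntop C E M Fo \<eta> S X))"
    unfolding Union_eta_syntop using topogenous_order_eta_rel[OF topo] .
  moreover have "interpolates C M X (\<Union>(eta_syntop C E M Fo \<eta> S X))" if "X \<in> Ob C" for X
    unfolding Union_eta_syntop
    \<comment> \<open>The (T2) property required here is that of the union of
      \<open>S (Fo X)\<close>, which is part of \<open>topo\<close>.\<close>
    by (rule interpolates_eta_rel[OF that])
      (use S topo Fo_in_Ob[OF that] in
        \<open>auto simp: topogenous_order_def syntopogenous_structure_def\<close>)
  ultimately show ?thesis
    by (simp add: syntopogenous_structure_def)
qed

text \<open>For each relation in \<open>S (Fo X)\<close>, its own transport is the relation on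
  \<open>X\<close> that continuity asks for.\<close>

lemma eta_continuous:
  assumes X: "X \<in> Ob C"
  shows "syntop_continuous C E M (eta_syntop C E M Fo \<eta> S) S (\<eta> X)"
proof -
  have "Dom C (\<eta> X) = X" "Cod C (\<eta> X) = Fo X"
    using eta_in_hom[OF X] by (auto simp: hom_iff)
  then show ?thesis
    using eta_rel_preimage[OF X] unfolding syntop_continuous_def eta_syntop_def by auto
qed

text \<open>A relation \<open>r'\<close> that answers continuity for \<open>s\<close> relates
  \<open>m\<close> to the inverse image of every witness \<open>p\<close>; (T2) for
  \<open>r'\<close> then enlarges this inverse image to \<open>n\<close>. So \<open>r'\<close>
  contains the whole transport of \<open>s\<close>.\<close>

lemma eta_syntop_le:
  assumes S': "syntopogenous_structure C M S'"
    and cont: "\<And>X. X \<in> Ob C \<Longrightarrow> syntop_continuous C E M S' S (\<eta> X)"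
  shows "syntop_le C (eta_syntop C E M Fo \<eta> S) S'"
  unfolding syntop_le_def
proof (intro ballI)
  fix X r assume X: "X \<in> Ob C" and "r \<in> eta_syntop C E M Fo \<eta> S X"
  then obtain s where s: "s \<in> S (Fo X)" "r = eta_rel C E M Fo \<eta> X s"
    by (auto simp: eta_syntop_def)
  note eta = eta_in_hom[OF X]
  obtain r' where r': "r' \<in> S' X" "\<And>m n. m \<in> sub C M X \<Longrightarrow> n \<in> sub C M (Fo X) \<Longrightarrow>
      (sub_image C E M (\<eta> X) m, n) \<in> s \<Longrightarrow> (m, sub_preimage C (\<eta> X) n) \<in> r'"
    using cont[OF X] s(1) eta unfolding syntop_continuous_def hom_iff by metis
  have T2: "T2 C M X r'"
    using S' X r'(1) by (auto simp: syntopogenous_structure_def)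
  have "r \<subseteq> r'"
  proof (rule subrelI)
    fix m n assume "(m, n) \<in> r"
    then obtain p where p: "m \<in> sub C M X" "n \<in> sub C M X" "p \<in> sub C M (Fo X)"
      "(sub_image C E M (\<eta> X) m, p) \<in> s" "sub_le C (sub_preimage C (\<eta> X) p) n"
      unfolding s(2) by (rule eta_relE)
    show "(m, n) \<in> r'"
      using T2D[OF T2 p(1,1) sub_preimage_in_sub[OF eta p(3)] p(2) sub_le_refl[OF p(1)]] r'(2) p
      by blast
  qed
  then show "\<exists>r' \<in> S' X. r \<subseteq> r'" using r'(1) by blast
qed

text \<open>Interpolation is transported one relation at a time, with (T2) for each relation taken
  from the first axiom of the structure \<open>S\<close>.\<close>

lemma interpolative_eta_syntop:
  assumes "syntopogenous_structure C M S" "interpolative C M S"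
  shows "interpolative C M (eta_syntop C E M Fo \<eta> S)"
  using assms interpolates_eta_rel Fo_in_Ob
  unfolding interpolative_def eta_syntop_def syntopogenous_structure_def by blast

lemma co_perfect_eta_syntop:
  assumes "co_perfect C M S"
  shows "co_perfect C M (eta_syntop C E M Fo \<eta> S)"
  using assms meet_preserving_eta_rel Fo_in_Ob unfolding co_perfect_def eta_syntop_def by blast

end

theorem theorem2:
  fixes C :: "('o, 'a) precategory" and E M :: "'a set"
    and Fo :: "'o \<Rightarrow> 'o" and Fa :: "'a \<Rightarrow> 'a" and \<eta> :: "'o \<Rightarrow> 'a"
    and S :: "'o \<Rightarrow> 'a sub_rel set"
  assumes "M_complete_category C E M"
    and "pullback_stable_along C E M"
    and "E_pointed_endofunctor C E Fo Fa \<eta>"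
    and "syntopogenous_structure C M S"
  defines "SF \<equiv> eta_syntop C E M Fo \<eta> S"
  shows "syntopogenous_structure C M SF
    \<and> (\<forall>X \<in> Ob C. syntop_continuous C E M SF S (\<eta> X))
    \<and> (\<forall>S'. syntopogenous_structure C M S'
          \<and> (\<forall>X \<in> Ob C. syntop_continuous C E M S' S (\<eta> X)) \<longrightarrow> syntop_le C SF S')
    \<and> (interpolative C M S \<longrightarrow> interpolative C M SF)
    \<and> (co_perfect C M S \<longrightarrow> co_perfect C M SF)"
proof -
  interpret M_complete_category C E M by fact
  interpret E_pointed_endofunctor C E Fo Fa \<eta> by fact
  interpret pointed_M_complete_category C E M Fo Fa \<eta> ..
  show ?thesis
    unfolding SF_def
    using syntopogenous_eta_syntop eta_continuous eta_syntop_le interpolative_eta_syntop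
      co_perfect_eta_syntop assms(4) by blast
qed

end
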